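(* Let $H\subset\mathbb{R}$ be bounded and infinite with $\mathrm{cl}(H\setminus H')=H$, and let $M\in\mathbb{R}$ be such that $|h|<M$ for all $h\in H$. Write $\{d(x,H'):x\in H\setminus H'\}=\{t_1,t_2,\dots\}$ with $t_1>t_2>\dots$, and for $n\in\mathbb{N}$ let $D_n=\{x\in H\setminus H': d(x,H')=t_n\}$ (a finite set), $g_n=\sum_{i=1}^n|D_i|$ and $A_n=\mathcal{A}(D_1\cup\dots\cup D_n)$. Let $(a_i)_{i\ge1}$ be an enumeration of $H\setminus H'$ without repetition such that for every $n\in\mathbb{N}$, $\{a_1,\dots,a_{g_n}\}=D_1\cup\dots\cup D_n$ and for every $j$ with $g_n<j\le g_{n+1}$, \[\mathcal{A}(a_1,\dots,a_j)\in\Big(\min\{A_n,A_{n+1}\}-\tfrac{2M}{g_n+1},\ \max\{A_n,A_{n+1}\}+\tfrac{2M}{g_n+1}\Big).\] Let $I=\{\frac1{2^n}:n\in\mathbb{N}\}$ with the usual metric, $f:I\to\mathbb{R}$, $f(\frac1{2^n})=a_n$, and let $s(K)=\mathcal{A}(f(K))$ for nonempty $K\in[I]^{<\infty}_{str}$. Then for every $A\in\mathbb{R}$: $\mathcal{M}^{iso}(H)=A$ if and only if $\mathrm{ext}_{str}(s,I)=A$.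
   Context: $\mathbb{N}=\{1,2,\dots\}$. $\mathcal{A}$ denotes the arithmetic mean of finitely many numbers, or of the elements of a finite set of reals. $\mathrm{cl}(H)$ is the closure and $H'$ the set of accumulation points of $H$ in $\mathbb{R}$; $d(x,H')=\inf\{|x-y|:y\in H'\}$ and, for $\delta>0$, $S(H',\delta)=\{y\in\mathbb{R}:d(y,H')<\delta\}$. For bounded $H\subset\mathbb{R}$ with $\mathrm{cl}(H\setminus H')=H$, $\mathcal{M}^{iso}(H)=\lim_{\delta\to0+}\mathcal{A}\big(H\setminus S(H',\delta)\big)$ if the limit exists (the set $H\setminus S(H',\delta)$ is finite for every $\delta>0$). For a set $I$, $[I]^{<\infty}$ is the set of all finite subsets of $I$. For a pseudo-metric space $(I,d)$, $A\subset I$ and $\epsilon>0$, let $S(A,\epsilon)=\bigcup_{x\in A}\{y\in I: d(x,y)<\epsilon\}$. The Hausdorff pseudo-metric on subsets of $I$ is $d_H(A,C)=\inf\{\epsilon>0: A\subset S(C,\epsilon),\ C\subset S(A,\epsilon)\}$ (with $\inf\emptyset=+\infty$). In a bounded space $I$, a set $K\subset I$ is stretched if $d(x,y)\ge d_H(K,I)$ for all $x,y\in K$ with $x\ne y$. $[I]^{<\infty}_{str}$ denotes the set of finite stretched subsets of $I$. Let $(I,d)$ be a totally bounded pseudo-metric space (for every $\delta>0$ there is a finite $K\subset I$ with $S(K,\delta)=I$), $s$ a real function on $[I]^{<\infty}_{str}$, and $A\in\mathbb{R}$. We write $\mathrm{ext}_{str}(s,I)=A$ if for every $\epsilon>0$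 there is $\delta>0$ such that $K\in[I]^{<\infty}_{str}$ and $d_H(K,I)<\delta$ imply $|s(K)-A|<\epsilon$. (The value of $s$ at $\emptyset$ is immaterial since $d_H(\emptyset,I)=+\infty$.) *)

theory Defs
  imports "HOL-Analysis.Analysis"
begin

text \<open>The index set \<^term>\<open>J\<close> is finite in every intended use; the value for empty
  \<^term>\<open>J\<close> is \<open>0 / 0 = 0\<close>.\<close>

definition fam_mean :: "('i \<Rightarrow> real) \<Rightarrow> 'i set \<Rightarrow> real"
  where "fam_mean x J = (\<Sum>i\<in>J. x i) / real (card J)"

definition set_mean :: "real set \<Rightarrow> real"
  where "set_mean S = fam_mean (\<lambda>x. x) S"

definition acc_points :: "real set \<Rightarrow> real set"
  where "acc_points H = {x. x islimpt H}"

text \<open>The distance to the empty set is \<open>+\<infinity>\<close>, whereas \<^term>\<open>infdist x {} = 0\<close>; hence the guard.\<close>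

definition nbhd :: "real set \<Rightarrow> real \<Rightarrow> real set"
  where "nbhd C \<delta> = {y. C \<noteq> {} \<and> infdist y C < \<delta>}"

text \<open>\<open>has_Miso H A\<close> says that \<open>\<M>\<^sup>i\<^sup>s\<^sup>o(H)\<close> exists and equals \<open>A\<close>. It is meant for
  bounded \<open>H\<close> with \<^prop>\<open>closure (H - acc_points H) = H\<close>; then all the sets averaged are finite.\<close>

definition has_Miso :: "real set \<Rightarrow> real \<Rightarrow> bool"
  where "has_Miso H A \<longleftrightarrow>
    ((\<lambda>\<delta>. set_mean (H - nbhd (acc_points H) \<delta>)) \<longlongrightarrow> A) (at_right 0)"

text \<open>In the following, \<open>d\<close> is a pseudo-metric on the carrier set \<open>I\<close>.\<close>

definition pm_nbhd :: "'a set \<Rightarrow> ('a \<Rightarrow> 'a \<Rightarrow> real) \<Rightarrow> 'a set \<Rightarrow> real \<Rightarrow> 'a set"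
  where "pm_nbhd I d A \<epsilon> = (\<Union>x\<in>A. {y \<in> I. d x y < \<epsilon>})"

text \<open>Extended real valued, so that the infimum of the empty set is \<open>+\<infinity>\<close>.\<close>

definition hausdorff_pm :: "'a set \<Rightarrow> ('a \<Rightarrow> 'a \<Rightarrow> real) \<Rightarrow> 'a set \<Rightarrow> 'a set \<Rightarrow> ereal"
  where "hausdorff_pm I d A C =
    Inf {ereal \<epsilon> | \<epsilon>. \<epsilon> > 0 \<and> A \<subseteq> pm_nbhd I d C \<epsilon> \<and> C \<subseteq> pm_nbhd I d A \<epsilon>}"

definition stretched :: "'a set \<Rightarrow> ('a \<Rightarrow> 'a \<Rightarrow> real) \<Rightarrow> 'a set \<Rightarrow> bool"
  where "stretched I d K \<longleftrightarrow>
    K \<subseteq> I \<and> (\<forall>x\<in>K. \<forall>y\<in>K. x \<noteq> y \<longrightarrow> hausdorff_pm I d K I \<le> ereal (d x y))"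

definition fin_stretched :: "'a set \<Rightarrow> ('a \<Rightarrow> 'a \<Rightarrow> real) \<Rightarrow> 'a set set"
  where "fin_stretched I d = {K. finite K \<and> stretched I d K}"

text \<open>\<open>has_ext_str I d s A\<close> renders \<open>ext\<^sub>s\<^sub>t\<^sub>r(s,I) = A\<close>, for totally bounded \<open>(I,d)\<close>. Only the
  values of \<open>s\<close> on \<^term>\<open>fin_stretched I d\<close> are used.\<close>

definition has_ext_str ::
    "'a set \<Rightarrow> ('a \<Rightarrow> 'a \<Rightarrow> real) \<Rightarrow> ('a set \<Rightarrow> real) \<Rightarrow> real \<Rightarrow> bool"
  where "has_ext_str I d s A \<longleftrightarrow>
    (\<forall>\<epsilon>>0. \<exists>\<delta>>0. \<forall>K\<in>fin_stretched I d.
      hausdorff_pm I d K I < ereal \<delta> \<longrightarrow> \<bar>s K - A\<bar> < \<epsilon>)"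

end

theory Submission
  imports Defs "HOL-Real_Asymp.Real_Asymp"
begin

text \<open>A finite stretched subset of \<open>I = {1/2, 1/4, 1/8, \<dots>}\<close> consists of an initial segment and
  at most one further point: if \<open>1/2\<^sup>m\<close> is the largest missing point, the Hausdorff distance
  to \<open>I\<close> is at least \<open>1/2\<^sup>m\<^sup>+\<^sup>1\<close>, while any two points below \<open>1/2\<^sup>m\<close> are closer to each
  other than that. One further point changes the mean of a bounded family by an amount that is
  negligible for long segments, so \<open>ext\<^sub>s\<^sub>t\<^sub>r(s,I)\<close> is the Cesaro limit of \<open>a\<close>. The means \<open>A\<^sub>n\<close>
  form a subsequence of the Cesaro means, and the bounds on the means between \<open>g\<^sub>n\<close> and
  \<open>g\<^sub>n\<^sub>+\<^sub>1\<close> make the whole sequence converge with it. Finally, \<open>H\<close> minus the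
  \<open>\<delta>\<close>-neighbourhood of \<open>H'\<close> is \<open>D\<^sub>1 \<union> \<dots> \<union> D\<^sub>n\<close> for \<open>t\<^sub>n\<^sub>+\<^sub>1 < \<delta> \<le> t\<^sub>n\<close>, and \<open>t\<^sub>n\<close> tends to
  \<open>0\<close> because \<open>H\<close> is bounded.\<close>

section \<open>Bounds for the Hausdorff distance\<close>

lemma hausdorff_pm_ge:
  assumes "y \<in> C" and "\<And>x. x \<in> K \<Longrightarrow> c \<le> d x y"
  shows "ereal c \<le> hausdorff_pm I d K C"
  unfolding hausdorff_pm_def
proof (rule Inf_greatest, clarify)
  fix \<epsilon> :: real
  assume "C \<subseteq> pm_nbhd I d K \<epsilon>"
  then obtain x where "x \<in> K" "d x y < \<epsilon>"
    using assms(1) by (auto simp: pm_nbhd_def)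
  with assms(2)[of x] show "ereal c \<le> ereal \<epsilon>" by simp
qed

lemma hausdorff_pm_le:
  assumes "0 < c" and "K \<subseteq> I" and "\<And>x. x \<in> I \<Longrightarrow> d x x = 0"
    and "\<And>y. y \<in> I \<Longrightarrow> \<exists>x\<in>K. d x y < c"
  shows "hausdorff_pm I d K I \<le> ereal c"
  unfolding hausdorff_pm_def
proof (rule Inf_lower)
  have "K \<subseteq> pm_nbhd I d I c" "I \<subseteq> pm_nbhd I d K c"
    using assms by (fastforce simp: pm_nbhd_def)+
  then show "ereal c \<in> {ereal \<epsilon> |\<epsilon>. 0 < \<epsilon> \<and> K \<subseteq> pm_nbhd I d I \<epsilon> \<and> I \<subseteq> pm_nbhd I d K \<epsilon>}"
    using assms(1) by blast
qed

section \<open>Finite stretched subsets of the dyadic points\<close>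

definition dyadic :: "nat \<Rightarrow> real"
  where "dyadic n = 1 / 2 ^ n"

lemma dyadic_pos: "0 < dyadic n"
  by (simp add: dyadic_def)

lemma dyadic_mono: "m \<le> n \<Longrightarrow> dyadic n \<le> dyadic m"
  by (simp add: dyadic_def frac_le)

lemma dyadic_Suc: "dyadic (Suc n) = dyadic n / 2"
  by (simp add: dyadic_def)

lemma inj_dyadic: "inj dyadic"
  by (rule injI) (simp add: dyadic_def)

lemma dyadic_tendsto_0: "dyadic \<longlonglongrightarrow> 0"
  using LIMSEQ_realpow_zero[of "1/2::real"] by (simp add: dyadic_def[abs_def] power_one_over)

text \<open>The smaller point is at most half the larger one, so the difference is at least that
  half; it is less than \<open>dyadic i\<close> because \<open>dyadic j\<close> is positive.\<close>

lemma dyadic_gap: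
  assumes "i < j"
  shows "dyadic j \<le> dist (dyadic i) (dyadic j)" "dyadic (Suc i) \<le> dist (dyadic i) (dyadic j)"
    and "dist (dyadic i) (dyadic j) < dyadic i"
proof -
  have "dyadic j \<le> dyadic (Suc i)"
    using assms by (intro dyadic_mono) simp
  then show "dyadic j \<le> dist (dyadic i) (dyadic j)" "dyadic (Suc i) \<le> dist (dyadic i) (dyadic j)"
    "dist (dyadic i) (dyadic j) < dyadic i"
    using dyadic_pos[of i] dyadic_pos[of j] by (auto simp: dyadic_Suc dist_real_def)
qed

lemma dyadic_dist_ge:
  assumes "i \<noteq> m"
  shows "dyadic (Suc m) \<le> dist (dyadic i) (dyadic m)"
proof (cases "i < m")
  case True
  then show ?thesis
    using dyadic_gap(1)[of i m] dyadic_mono[of m "Suc m"] by simp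
next
  case False
  then show ?thesis
    using dyadic_gap(2)[of m i] assms by (simp add: dist_commute)
qed

text \<open>The omitted points lie strictly between 0 and the last point \<open>dyadic n\<close> of
  the segment, which is therefore closer than \<open>dyadic n\<close> to each of them.\<close>

lemma hausdorff_dyadic_segment:
  assumes "1 \<le> n"
  shows "hausdorff_pm (dyadic ` {1..}) dist (dyadic ` {1..n}) (dyadic ` {1..}) \<le> ereal (dyadic n)"
proof (rule hausdorff_pm_le)
  fix y assume "y \<in> dyadic ` {1..}"
  then obtain m where m: "1 \<le> m" "y = dyadic m" by auto
  show "\<exists>x\<in>dyadic ` {1..n}. dist x y < dyadic n"
  proof (cases "m \<le> n")
    case True
    then show ?thesis using m dyadic_pos[of n] by (intro bexI[of _ y]) auto
  next
    case False
    then show ?thesis using m assms dyadic_gap(3)[of n m] by (intro bexI[of _ "dyadic n"]) auto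
  qed
qed (auto simp: dyadic_pos)

text \<open>Distinct points of the segment differ by at least the smaller one, hence by at least
  \<open>dyadic n\<close>, which bounds the Hausdorff distance. So initial segments may serve as
  test sets for \<open>has_ext_str\<close>.\<close>

lemma fin_stretched_dyadic_segment:
  assumes "1 \<le> n"
  shows "dyadic ` {1..n} \<in> fin_stretched (dyadic ` {1..}) dist"
proof -
  have gap: "dyadic n \<le> dist (dyadic i) (dyadic j)" if "i \<noteq> j" "i \<le> n" "j \<le> n" for i j
    using dyadic_gap(1)[of i j] dyadic_gap(1)[of j i] that
      dyadic_mono[of j n] dyadic_mono[of i n] by (cases i j rule: linorder_cases) (auto simp: dist_commute)
  have "hausdorff_pm (dyadic ` {1..}) dist (dyadic ` {1..n}) (dyadic ` {1..}) \<le> ereal (dist x y)"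
    if "x \<in> dyadic ` {1..n}" "y \<in> dyadic ` {1..n}" "x \<noteq> y" for x y
  proof (rule order_trans[OF hausdorff_dyadic_segment[OF assms]])
    show "ereal (dyadic n) \<le> ereal (dist x y)"
      using that by (auto simp: inj_eq[OF inj_dyadic] intro: gap)
  qed
  then show ?thesis
    by (auto simp: fin_stretched_def stretched_def)
qed

text \<open>The shape of \<open>K\<close> comes from its being finite and stretched; the small
  distance makes the initial segment long.\<close>

lemma fin_stretched_dyadic_cases:
  assumes K: "K \<in> fin_stretched (dyadic ` {1..}) dist"
    and small: "hausdorff_pm (dyadic ` {1..}) dist K (dyadic ` {1..}) < ereal (dyadic (Suc N))"
  obtains n where "N \<le> n" "K = dyadic ` {1..n}"
  | n q where "N \<le> n" "n < q" "K = dyadic ` insert q {1..n}"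
proof -
  define J where "J = {j. 1 \<le> j \<and> dyadic j \<in> K}"
  have KI: "K \<subseteq> dyadic ` {1..}" and finK: "finite K"
    using K by (auto simp: fin_stretched_def stretched_def)
  have KJ: "K = dyadic ` J"
    using KI by (auto simp: J_def)
  then have "finite J"
    using finK finite_imageD inj_dyadic inj_on_subset by blast
  \<comment> \<open>Inserting 0 makes \<open>m0\<close> positive, so that \<open>m0 - 1\<close>
    witnesses the \<open>LEAST\<close> below.\<close>
  then obtain m0 where "m0 \<notin> insert 0 J"
    using ex_new_if_finite[OF infinite_UNIV_nat, of "insert 0 J"] by auto
  define n where "n = (LEAST n. Suc n \<notin> J)"
  have n: "Suc n \<notin> J"
    unfolding n_def by (rule LeastI[of _ "m0 - 1"]) (use \<open>m0 \<notin> insert 0 J\<close> in auto)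
  have initial: "{1..n} \<subseteq> J"
  proof
    fix i assume "i \<in> {1..n}"
    then show "i \<in> J" using not_less_Least[of "i - 1" "\<lambda>n. Suc n \<notin> J"] by (auto simp: n_def)
  qed
  \<comment> \<open>\<open>dyadic (Suc n)\<close> is missing from \<open>K\<close>, and its nearest
    neighbour is \<open>dyadic (Suc (Suc n))\<close>, exactly half as large and so at distance
    \<open>dyadic (Suc (Suc n))\<close>.\<close>
  have far: "ereal (dyadic (Suc (Suc n))) \<le> hausdorff_pm (dyadic ` {1..}) dist K (dyadic ` {1..})"
  proof (rule hausdorff_pm_ge[where y = "dyadic (Suc n)"])
    fix x assume "x \<in> K"
    then obtain i where "i \<in> J" "x = dyadic i" using KJ by auto
    then show "dyadic (Suc (Suc n)) \<le> dist x (dyadic (Suc n))"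
      using n by (auto intro: dyadic_dist_ge)
  qed simp
  then have "dyadic (Suc (Suc n)) < dyadic (Suc N)"
    using small le_less_trans by fastforce
  then have "N \<le> n"
    using dyadic_mono[of "Suc (Suc n)" "Suc N"] by linarith
  \<comment> \<open>Since \<open>Suc n\<close> is missing, both indices are at least
    \<open>n + 2\<close>. Two such points are less than \<open>dyadic (n + 2)\<close> apart, while
    stretchedness and \<open>far\<close> demand at least that much.\<close>
  have single: False if "i \<in> J" "j \<in> J" "n < i" "i < j" for i j
  proof -
    have "Suc (Suc n) \<le> i" using that n by (metis Suc_leI le_eq_less_or_eq)
    have "hausdorff_pm (dyadic ` {1..}) dist K (dyadic ` {1..}) \<le> ereal (dist (dyadic i) (dyadic j))"
      using K that KJ inj_dyadic by (auto simp: fin_stretched_def stretched_def inj_eq)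
    with far have "ereal (dyadic (Suc (Suc n))) \<le> ereal (dist (dyadic i) (dyadic j))"
      by (rule order_trans)
    then show False
      using dyadic_gap(3)[OF \<open>i < j\<close>] dyadic_mono[OF \<open>Suc (Suc n) \<le> i\<close>] by simp
  qed
  show thesis
  proof (cases "J \<subseteq> {1..n}")
    case True
    then show thesis using that(1)[of n] \<open>N \<le> n\<close> initial KJ by auto
  next
    case False
    then obtain q where q: "q \<in> J" "n < q" by (auto simp: J_def subset_iff)
    have "j \<in> insert q {1..n}" if "j \<in> J" for j
    proof (cases "j \<le> n")
      case True
      then show ?thesis using that by (simp add: J_def)
    next
      case False
      then show ?thesis
        using single[of j q] single[of q j] that q by (cases j q rule: linorder_cases) auto
    qed
    then have "J = insert q {1..n}"
      using initial q(1) by blast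
    then show thesis using that(2)[of n q] \<open>N \<le> n\<close> q KJ by auto
  qed
qed

section \<open>Means of bounded families and the Cesaro limit\<close>

lemma set_mean_image:
  assumes "inj_on x J"
  shows "set_mean (x ` J) = fam_mean x J"
  using assms by (simp add: set_mean_def fam_mean_def sum.reindex card_image)

lemma abs_fam_mean_le:
  assumes "0 \<le> M" and "\<And>i. i \<in> J \<Longrightarrow> \<bar>x i\<bar> \<le> M"
  shows "\<bar>fam_mean x J\<bar> \<le> M"
\<comment> \<open>This case covers empty and infinite \<open>J\<close>; the mean is then 0, by
  division by zero.\<close>
proof (cases "card J = 0")
  case True
  then show ?thesis using assms(1) by (simp add: fam_mean_def)
next
  case False
  have "\<bar>\<Sum>i\<in>J. x i\<bar> \<le> real (card J) * M"
    using assms(2) by (intro order_trans[OF sum_abs] sum_bounded_above) auto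
  then show ?thesis using False by (simp add: fam_mean_def field_simps)
qed

text \<open>The change is exactly \<open>(x q - fam_mean x J) / (card J + 1)\<close>, and both terms
  of the numerator lie in \<open>[-M, M]\<close>.\<close>

lemma fam_mean_insert_diff:
  assumes "finite J" "J \<noteq> {}" "q \<notin> J" "0 \<le> M" and bound: "\<And>i. i \<in> insert q J \<Longrightarrow> \<bar>x i\<bar> \<le> M"
  shows "\<bar>fam_mean x (insert q J) - fam_mean x J\<bar> \<le> 2 * M / (real (card J) + 1)"
proof -
  have "card J > 0" using assms by (simp add: card_gt_0_iff)
  then have "fam_mean x (insert q J) - fam_mean x J = (x q - fam_mean x J) / (real (card J) + 1)"
    using assms by (simp add: fam_mean_def divide_simps) (simp add: algebra_simps)
  moreover have "\<bar>x q - fam_mean x J\<bar> \<le> 2 * M"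
    using abs_fam_mean_le[of M J x] bound[of q] assms by fastforce
  ultimately show ?thesis
    by (simp add: divide_right_mono)
qed

text \<open>A set mean counts repeated values once; injectivity of \<open>a\<close> makes it agree
  with the mean over indices. Initial segments then give the Cesaro means themselves, and a further
  point costs at most \<open>2 * M / (n + 1)\<close>.\<close>

lemma has_ext_str_dyadic_iff:
  fixes a :: "nat \<Rightarrow> real"
  assumes inj: "inj_on a {1..}" and bound: "\<And>n. 1 \<le> n \<Longrightarrow> \<bar>a n\<bar> \<le> M"
    and f: "\<And>n. 1 \<le> n \<Longrightarrow> f (dyadic n) = a n"
    and s: "\<And>K. K \<in> fin_stretched (dyadic ` {1..}) dist \<Longrightarrow> K \<noteq> {} \<Longrightarrow> s K = set_mean (f ` K)"
  shows "has_ext_str (dyadic ` {1..}) dist s A \<longleftrightarrow> (\<lambda>n. fam_mean a {1..n}) \<longlonglongrightarrow> A"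
    (is "_ \<longleftrightarrow> ?c \<longlonglongrightarrow> A")
proof
  have "0 \<le> M" using bound[of 1] by linarith
  have mean: "s (dyadic ` J) = fam_mean a J"
    if "dyadic ` J \<in> fin_stretched (dyadic ` {1..}) dist" "J \<noteq> {}" "J \<subseteq> {1..}" for J
  proof -
    have "f ` dyadic ` J = a ` J"
      unfolding image_image using that(3) f by (intro image_cong) auto
    then show ?thesis
      using s[OF that(1)] that(2,3) set_mean_image[OF inj_on_subset[OF inj]] by simp
  qed
  {
    assume ext: "has_ext_str (dyadic ` {1..}) dist s A"
    show "?c \<longlonglongrightarrow> A"
    proof (rule LIMSEQ_I)
      fix \<epsilon> :: real assume "0 < \<epsilon>"
      with ext obtain \<delta> where "0 < \<delta>" and \<delta>:
        "\<And>K. K \<in> fin_stretched (dyadic ` {1..}) dist \<Longrightarrow>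
          hausdorff_pm (dyadic ` {1..}) dist K (dyadic ` {1..}) < ereal \<delta> \<Longrightarrow> \<bar>s K - A\<bar> < \<epsilon>"
        unfolding has_ext_str_def by blast
      obtain N where N: "\<And>n. N \<le> n \<Longrightarrow> dyadic n < \<delta>"
        using order_tendstoD(2)[OF dyadic_tendsto_0 \<open>0 < \<delta>\<close>] by (auto simp: eventually_sequentially)
      \<comment> \<open>The successor ensures \<open>1 \<le> n\<close>, so that the segment is
        nonempty.\<close>
      have "norm (?c n - A) < \<epsilon>" if "Suc N \<le> n" for n
      proof -
        have "1 \<le> n" using that by simp
        have "hausdorff_pm (dyadic ` {1..}) dist (dyadic ` {1..n}) (dyadic ` {1..}) < ereal \<delta>"
          using N[of n] that by (intro le_less_trans[OF hausdorff_dyadic_segment[OF \<open>1 \<le> n\<close>]]) auto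
        then have "\<bar>s (dyadic ` {1..n}) - A\<bar> < \<epsilon>"
          using \<delta> fin_stretched_dyadic_segment \<open>1 \<le> n\<close> by blast
        then show ?thesis
          using mean[OF fin_stretched_dyadic_segment[OF \<open>1 \<le> n\<close>]] \<open>1 \<le> n\<close> by auto
      qed
      then show "\<exists>no. \<forall>n\<ge>no. norm (?c n - A) < \<epsilon>" by blast
    qed
  }
  assume lim: "?c \<longlonglongrightarrow> A"
  show "has_ext_str (dyadic ` {1..}) dist s A"
    unfolding has_ext_str_def
  proof (intro allI impI)
    fix \<epsilon> :: real assume "0 < \<epsilon>"
    have "(\<lambda>n. 2 * M / (real n + 1)) \<longlonglongrightarrow> 0"
      by real_asymp
    then obtain N1 where N1: "\<And>n. N1 \<le> n \<Longrightarrow> 2 * M / (real n + 1) < \<epsilon> / 2"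
      using LIMSEQ_D[of "\<lambda>n. 2 * M / (real n + 1)" 0 "\<epsilon> / 2"] \<open>0 < \<epsilon>\<close>
      by (metis abs_less_iff diff_zero half_gt_zero real_norm_def)
    obtain N2 where N2: "\<And>n. N2 \<le> n \<Longrightarrow> \<bar>?c n - A\<bar> < \<epsilon> / 2"
      using LIMSEQ_D[OF lim, of "\<epsilon> / 2"] \<open>0 < \<epsilon>\<close> by auto
    \<comment> \<open>The successor again excludes the empty segment, on which \<open>s\<close> is
      unspecified.\<close>
    define N where "N = Suc (max N1 N2)"
    have "\<bar>s K - A\<bar> < \<epsilon>"
      if K: "K \<in> fin_stretched (dyadic ` {1..}) dist"
        and "hausdorff_pm (dyadic ` {1..}) dist K (dyadic ` {1..}) < ereal (dyadic (Suc N))" for K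
      using that
    proof (cases rule: fin_stretched_dyadic_cases)
      case (1 n)
      then have "s K = fam_mean a {1..n}" "\<bar>fam_mean a {1..n} - A\<bar> < \<epsilon> / 2"
        using mean[of "{1..n}"] K N2[of n] by (auto simp: N_def)
      then show ?thesis
        using \<open>0 < \<epsilon>\<close> by linarith
    next
      case (2 n q)
      have "\<bar>fam_mean a (insert q {1..n}) - fam_mean a {1..n}\<bar> \<le> 2 * M / (real (card {1..n}) + 1)"
        by (rule fam_mean_insert_diff) (use 2 \<open>0 \<le> M\<close> bound in \<open>auto simp: N_def\<close>)
      moreover have "s K = fam_mean a (insert q {1..n})"
        using mean[of "insert q {1..n}"] K 2 by auto
      moreover have "2 * M / (real (card {1..n}) + 1) < \<epsilon> / 2" "\<bar>fam_mean a {1..n} - A\<bar> < \<epsilon> / 2"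
        using N1[of n] N2[of n] 2 by (auto simp: N_def)
      ultimately show ?thesis
        by linarith
    qed
    then show "\<exists>\<delta>>0. \<forall>K\<in>fin_stretched (dyadic ` {1..}) dist.
        hausdorff_pm (dyadic ` {1..}) dist K (dyadic ` {1..}) < ereal \<delta> \<longrightarrow> \<bar>s K - A\<bar> < \<epsilon>"
      using dyadic_pos[of "Suc N"] by blast
  qed
qed

section \<open>Convergence along blocks and of step functions\<close>

text \<open>One direction passes to the subsequence \<open>c (g n)\<close>. For the other, each late
  \<open>j\<close> falls into a block whose two neighbouring values of \<open>x\<close> are close to
  \<open>A\<close>, and \<open>c j\<close> lies between them up to \<open>e n\<close>.\<close>

lemma tendsto_blockwise:
  fixes c x :: "nat \<Rightarrow> real" and g :: "nat \<Rightarrow> nat"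
  assumes g: "filterlim g at_top sequentially"
    and x: "\<And>n. 1 \<le> n \<Longrightarrow> x n = c (g n)"
    and e: "e \<longlonglongrightarrow> 0"
    and between: "\<And>n j. 1 \<le> n \<Longrightarrow> g n < j \<Longrightarrow> j \<le> g (n + 1) \<Longrightarrow>
      c j \<in> {min (x n) (x (n + 1)) - e n <..< max (x n) (x (n + 1)) + e n}"
  shows "x \<longlonglongrightarrow> A \<longleftrightarrow> c \<longlonglongrightarrow> A"
proof
  assume "c \<longlonglongrightarrow> A"
  then have "(\<lambda>n. c (g n)) \<longlonglongrightarrow> A"
    using g by (rule filterlim_compose)
  then show "x \<longlonglongrightarrow> A"
    by (rule Lim_transform_eventually)
      (use x in \<open>auto simp: eventually_sequentially intro!: exI[of _ 1]\<close>)
next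
  assume xA: "x \<longlonglongrightarrow> A"
  show "c \<longlonglongrightarrow> A"
  proof (rule LIMSEQ_I)
    fix \<epsilon> :: real assume "0 < \<epsilon>"
    obtain N1 where N1: "\<And>n. N1 \<le> n \<Longrightarrow> \<bar>x n - A\<bar> < \<epsilon> / 2"
      using LIMSEQ_D[OF xA, of "\<epsilon> / 2"] \<open>0 < \<epsilon>\<close> by auto
    obtain N2 where N2: "\<And>n. N2 \<le> n \<Longrightarrow> \<bar>e n\<bar> < \<epsilon> / 2"
      using LIMSEQ_D[OF e, of "\<epsilon> / 2"] \<open>0 < \<epsilon>\<close> by auto
    define N where "N = Suc (max N1 N2)"
    have "norm (c j - A) < \<epsilon>" if "Suc (g N) \<le> j" for j
    proof -
      obtain k where k: "N \<le> k" "j \<le> g k"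
        using g by (auto simp: filterlim_at_top eventually_sequentially)
          (meson nle_le)
      \<comment> \<open>The block containing \<open>j\<close> ends at the first \<open>m\<close>
        from \<open>N\<close> on with \<open>j \<le> g m\<close>. As \<open>j\<close> exceeds
        \<open>g N\<close>, this \<open>m\<close> has a predecessor \<open>n \<ge> N\<close>, and
        minimality gives \<open>g n < j\<close>.\<close>
      define m where "m = (LEAST m. N \<le> m \<and> j \<le> g m)"
      have m: "N \<le> m" "j \<le> g m"
        using LeastI[of "\<lambda>m. N \<le> m \<and> j \<le> g m" k] k by (auto simp: m_def)
      have "m \<noteq> N" using m that by auto
      then obtain n where n: "m = n + 1" "N \<le> n"
        using m by (metis Suc_eq_plus1 Suc_leI le_neq_implies_less less_imp_Suc_add le_add1 add_Suc_right)
      have "g n < j"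
        using not_less_Least[of n "\<lambda>m. N \<le> m \<and> j \<le> g m"] n by (auto simp: m_def[symmetric])
      then have "c j \<in> {min (x n) (x (n + 1)) - e n <..< max (x n) (x (n + 1)) + e n}"
        using between[of n j] m n by (auto simp: N_def)
      moreover have "\<bar>x n - A\<bar> < \<epsilon> / 2" "\<bar>x (n + 1) - A\<bar> < \<epsilon> / 2" "\<bar>e n\<bar> < \<epsilon> / 2"
        using N1[of n] N1[of "n + 1"] N2[of n] n by (auto simp: N_def)
      ultimately show ?thesis
        by (auto simp: abs_if min_def max_def split: if_splits)
    qed
    then show "\<exists>no. \<forall>j\<ge>no. norm (c j - A) < \<epsilon>" by blast
  qed
qed

text \<open>Sampling \<open>F\<close> at the right endpoints \<open>t n\<close> recovers
  \<open>x\<close>. Conversely, every small positive \<delta> lies in one of the intervals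
  \<open>(t (n + 1), t n]\<close>, on which \<open>F\<close> is constant.\<close>

lemma tendsto_at_right_0_step:
  fixes t x :: "nat \<Rightarrow> real" and F :: "real \<Rightarrow> real"
  assumes t0: "t \<longlonglongrightarrow> 0" and pos: "\<And>n. 1 \<le> n \<Longrightarrow> 0 < t n"
    and dec: "\<And>m n. 1 \<le> m \<Longrightarrow> m < n \<Longrightarrow> t n < t m"
    and F: "\<And>n \<delta>. 1 \<le> n \<Longrightarrow> t (n + 1) < \<delta> \<Longrightarrow> \<delta> \<le> t n \<Longrightarrow> F \<delta> = x n"
  shows "(F \<longlongrightarrow> A) (at_right 0) \<longleftrightarrow> x \<longlonglongrightarrow> A"
proof
  assume "(F \<longlongrightarrow> A) (at_right 0)"
  moreover have "filterlim t (at_right 0) sequentially"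
    using t0 pos by (force simp: filterlim_at eventually_sequentially intro!: exI[of _ 1])
  ultimately have "(\<lambda>n. F (t n)) \<longlonglongrightarrow> A"
    by (rule filterlim_compose)
  moreover have "F (t n) = x n" if "1 \<le> n" for n
    using F[of n "t n"] dec[of n "n + 1"] that by simp
  ultimately show "x \<longlonglongrightarrow> A"
    by (elim Lim_transform_eventually) (auto simp: eventually_sequentially intro!: exI[of _ 1])
next
  assume xA: "x \<longlonglongrightarrow> A"
  show "(F \<longlongrightarrow> A) (at_right 0)"
  proof (rule tendstoI)
    fix \<epsilon> :: real assume "0 < \<epsilon>"
    then obtain N0 where N0: "\<And>n. N0 \<le> n \<Longrightarrow> dist (x n) A < \<epsilon>"
      using tendstoD[OF xA] by (auto simp: eventually_sequentially)
    define N where "N = Suc N0"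
    have "dist (F \<delta>) A < \<epsilon>" if "0 < \<delta>" "\<delta> < t N" for \<delta>
    proof -
      obtain k where k: "t k < \<delta>" "N \<le> k"
        using order_tendstoD(2)[OF t0 \<open>0 < \<delta>\<close>] unfolding eventually_sequentially
        by (meson nle_le)
      \<comment> \<open>The first level below \<delta> from \<open>N\<close> on is not
        \<open>t N\<close>, so its predecessor is the right endpoint of the interval sought.\<close>
      define m where "m = (LEAST m. N \<le> m \<and> t m < \<delta>)"
      have m: "N \<le> m" "t m < \<delta>"
        using LeastI[of "\<lambda>m. N \<le> m \<and> t m < \<delta>" k] k by (auto simp: m_def)
      have "m \<noteq> N" using m that by auto
      then obtain n where n: "m = n + 1" "N \<le> n"
        using m by (metis Suc_eq_plus1 Suc_leI le_neq_implies_less less_imp_Suc_add le_add1 add_Suc_right)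
      have "\<delta> \<le> t n"
        using not_less_Least[of n "\<lambda>m. N \<le> m \<and> t m < \<delta>"] n by (auto simp: m_def[symmetric])
      then have "F \<delta> = x n"
        using F[of n \<delta>] m n by (auto simp: N_def)
      then show ?thesis using N0[of n] n by (simp add: N_def)
    qed
    then show "\<forall>\<^sub>F \<delta> in at_right 0. dist (F \<delta>) A < \<epsilon>"
      using pos[of N] unfolding eventually_at_right_field by (auto simp: N_def)
  qed
qed

section \<open>The isolated mean as a limit over distance layers\<close>

text \<open>If the set were infinite, Bolzano-Weierstrass would give it an accumulation point, which
  belongs to \<open>acc_points H\<close>; but points of the set are closer to it than
  \<delta>.\<close>

lemma finite_Diff_nbhd_acc_points:
  assumes "bounded H" "0 < \<delta>"
  shows "finite (H - nbhd (acc_points H) \<delta>)"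
proof (rule ccontr)
  let ?S = "H - nbhd (acc_points H) \<delta>"
  assume "infinite ?S"
  then obtain x where x: "x islimpt ?S"
    using bounded_infinite_imp_islimpt[of ?S ?S] assms(1) bounded_diff by blast
  then have "x \<in> acc_points H"
    using islimpt_subset[OF x Diff_subset] by (simp add: acc_points_def)
  moreover obtain y where "y \<in> ?S" "dist y x < \<delta>"
    using x assms(2) by (auto simp: islimpt_approachable)
  ultimately show False
    using infdist_le[of x "acc_points H" y] by (auto simp: nbhd_def)
qed

lemma acc_points_nonempty:
  assumes "bounded H" "infinite H"
  shows "acc_points H \<noteq> {}"
  using bounded_infinite_imp_islimpt[of H H] assms by (auto simp: acc_points_def)

text \<open>The set of accumulation points is closed. It is also nonempty, which matters because
  \<open>infdist x {} = 0\<close>.\<close>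

lemma infdist_acc_points_pos:
  assumes "bounded H" "infinite H" "x \<notin> acc_points H"
  shows "0 < infdist x (acc_points H)"
proof -
  have "closed (acc_points H)"
    unfolding acc_points_def by (rule closed_limpts)
  then show ?thesis
    using assms acc_points_nonempty in_closed_iff_infdist_zero[of "acc_points H" x] infdist_nonneg[of x "acc_points H"]
    by (metis le_less)
qed

text \<open>Accumulation points have distance 0 and are removed with the neighbourhood; nonemptiness
  settles the guard in \<open>nbhd\<close>.\<close>

lemma Diff_nbhd_acc_points:
  assumes "bounded H" "infinite H" "0 < \<delta>"
  shows "H - nbhd (acc_points H) \<delta> = {x \<in> H - acc_points H. \<delta> \<le> infdist x (acc_points H)}"
  using assms(3) acc_points_nonempty[OF assms(1,2)] by (auto simp: nbhd_def)

lemma has_Miso_iff_tendsto_layers: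
  fixes t :: "nat \<Rightarrow> real"
  assumes H: "bounded H" "infinite H"
    and t_image: "t ` {1..} = {infdist x (acc_points H) | x. x \<in> H - acc_points H}"
    and dec: "\<And>m n. 1 \<le> m \<Longrightarrow> m < n \<Longrightarrow> t n < t m"
    and D: "\<And>n. 1 \<le> n \<Longrightarrow> D n = {x \<in> H - acc_points H. infdist x (acc_points H) = t n}"
  shows "has_Miso H A \<longleftrightarrow> (\<lambda>n. set_mean (\<Union>i\<in>{1..n}. D i)) \<longlonglongrightarrow> A"
  unfolding has_Miso_def
proof (rule tendsto_at_right_0_step)
  have ex: "\<exists>x. x \<in> H - acc_points H \<and> infdist x (acc_points H) = t n" if "1 \<le> n" for n
  proof -
    have "t n \<in> t ` {1..}" using that by simp
    then show ?thesis unfolding t_image by auto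
  qed
  show pos: "0 < t n" if "1 \<le> n" for n
    using ex[OF that] infdist_acc_points_pos[OF H] by (metis DiffD2)
  show "t \<longlonglongrightarrow> 0"
  proof (rule LIMSEQ_I)
    fix \<epsilon> :: real assume "0 < \<epsilon>"
    have "\<exists>N\<ge>1. t N < \<epsilon>"
    proof (rule ccontr)
      assume no: "\<not> ?thesis"
      \<comment> \<open>Otherwise infinitely many distinct levels would be at least \<epsilon>, yet
        all of them are distances of points in a finite set.\<close>
      have "inj_on t {1..}"
        by (rule linorder_inj_onI) (use dec in fastforce)+
      then have "infinite (t ` {1..})"
        using finite_imageD infinite_Ici by blast
      moreover have "t ` {1..} \<subseteq> (\<lambda>x. infdist x (acc_points H)) ` (H - nbhd (acc_points H) \<epsilon>)"
      proof (clarsimp simp: Diff_nbhd_acc_points[OF H \<open>0 < \<epsilon>\<close>])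
        fix n :: nat assume "Suc 0 \<le> n"
        then have "\<epsilon> \<le> t n" using no by auto
        then show "t n \<in> (\<lambda>x. infdist x (acc_points H)) `
            {x \<in> H. x \<notin> acc_points H \<and> \<epsilon> \<le> infdist x (acc_points H)}"
          using ex[of n] \<open>Suc 0 \<le> n\<close> by force
      qed
      ultimately show False
        using finite_Diff_nbhd_acc_points[OF H(1) \<open>0 < \<epsilon>\<close>] finite_surj by blast
    qed
    then obtain N where N: "1 \<le> N" "t N < \<epsilon>" by blast
    have "norm (t n - 0) < \<epsilon>" if "N \<le> n" for n
      using dec[of N n] pos[of n] N that by (cases "N = n") auto
    then show "\<exists>no. \<forall>n\<ge>no. norm (t n - 0) < \<epsilon>" by blast
  qed
  show "set_mean (H - nbhd (acc_points H) \<delta>) = set_mean (\<Union>i\<in>{1..n}. D i)"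
    if n: "1 \<le> n" "t (n + 1) < \<delta>" "\<delta> \<le> t n" for n \<delta>
  proof -
    have "0 < \<delta>" using pos[of "n + 1"] that by simp
    \<comment> \<open>The neighbourhood is open, so a layer at distance exactly \<delta> survives:
      the comparison is weak.\<close>
    have level: "\<delta> \<le> t i \<longleftrightarrow> i \<le> n" if "1 \<le> i" for i
    proof
      assume "\<delta> \<le> t i"
      then show "i \<le> n"
        using dec[of "n + 1" i] n by (cases "i = n + 1") (auto simp: not_less[symmetric])
    next
      assume "i \<le> n"
      then show "\<delta> \<le> t i" using dec[of i n] that n by (cases "i = n") auto
    qed
    have "{x \<in> H - acc_points H. \<delta> \<le> infdist x (acc_points H)} = (\<Union>i\<in>{1..n}. D i)"
    proof (intro equalityI subsetI)
      fix x assume x: "x \<in> {x \<in> H - acc_points H. \<delta> \<le> infdist x (acc_points H)}"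
      then have "infdist x (acc_points H) \<in> t ` {1..}" unfolding t_image by blast
      then obtain i where i: "1 \<le> i" "infdist x (acc_points H) = t i" by auto
      then show "x \<in> (\<Union>i\<in>{1..n}. D i)"
        using x level[of i] D[of i] by auto
    next
      fix x assume "x \<in> (\<Union>i\<in>{1..n}. D i)"
      then obtain i where i: "1 \<le> i" "i \<le> n" "x \<in> D i" by auto
      then show "x \<in> {x \<in> H - acc_points H. \<delta> \<le> infdist x (acc_points H)}"
        using level[of i] D[of i] by simp
    qed
    then show ?thesis
      unfolding Diff_nbhd_acc_points[OF H \<open>0 < \<delta>\<close>] by simp
  qed
qed (fact dec)

section \<open>The isolated mean as a stretched extension\<close>

theorem theorem4p22:
  fixes H :: "real set" and M :: real
    and t :: "nat \<Rightarrow> real" and D :: "nat \<Rightarrow> real set" and g :: "nat \<Rightarrow> nat"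
    and An :: "nat \<Rightarrow> real" and a :: "nat \<Rightarrow> real"
    and I :: "real set" and f :: "real \<Rightarrow> real" and s :: "real set \<Rightarrow> real" and A :: real
  assumes "bounded H" and "infinite H"
    and "closure (H - acc_points H) = H"
    and "\<forall>h\<in>H. \<bar>h\<bar> < M"
    and "t ` {1..} = {infdist x (acc_points H) | x. x \<in> H - acc_points H}"
    and "\<forall>m\<ge>1. \<forall>n>m. t n < t m"
    and "\<forall>n\<ge>1. D n = {x \<in> H - acc_points H. infdist x (acc_points H) = t n}"
    and "\<forall>n\<ge>1. g n = (\<Sum>i=1..n. card (D i))"
    and "\<forall>n\<ge>1. An n = set_mean (\<Union>i\<in>{1..n}. D i)"
    and "bij_betw a {1..} (H - acc_points H)"
    and "\<forall>n\<ge>1. a ` {1..g n} = (\<Union>i\<in>{1..n}. D i)"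
    and "\<forall>n\<ge>1. \<forall>j. g n < j \<and> j \<le> g (n + 1) \<longrightarrow>
           fam_mean a {1..j} \<in> {min (An n) (An (n + 1)) - 2 * M / (real (g n) + 1) <..<
                                max (An n) (An (n + 1)) + 2 * M / (real (g n) + 1)}"
    and "I = {1 / 2 ^ n | n::nat. n \<ge> 1}"
    and "\<forall>n\<ge>1. f (1 / 2 ^ n) = a n"
    and "\<forall>K\<in>fin_stretched I dist. K \<noteq> {} \<longrightarrow> s K = set_mean (f ` K)"
  shows "has_Miso H A \<longleftrightarrow> has_ext_str I dist s A"
proof -
  note H = assms(1,2) and a_bij = assms(10)
  have t_image: "t ` {1..} = {infdist x (acc_points H) | x. x \<in> H - acc_points H}"
    by (fact assms(5))
  have dec: "t n < t m" if "1 \<le> m" "m < n" for m n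
    using assms(6) that by blast
  have D: "D n = {x \<in> H - acc_points H. infdist x (acc_points H) = t n}" if "1 \<le> n" for n
    using assms(7) that by blast
  have inj: "inj_on a {1..}" and a_in: "\<And>n. 1 \<le> n \<Longrightarrow> a n \<in> H"
    using a_bij by (auto simp: bij_betw_def)
  \<comment> \<open>The layers lie in the image under \<open>a\<close> of a finite set of
    indices.\<close>
  have D_fin: "finite (D n)" if "1 \<le> n" for n
  proof -
    have "finite (\<Union>i\<in>{1..n}. D i)"
      using assms(11) that by (metis finite_atLeastAtMost finite_imageI)
    then show ?thesis using that by (auto simp: finite_UN)
  qed
  have D_ne: "D n \<noteq> {}" if "1 \<le> n" for n
  proof -
    have "t n \<in> t ` {1..}" using that by simp
    then show ?thesis unfolding t_image using D[OF that] by auto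
  qed
  \<comment> \<open>Each layer contributes at least one point, which forces \<open>g\<close> to
    infinity.\<close>
  have g_ge: "n \<le> g n" if "1 \<le> n" for n
  proof -
    have "(\<Sum>i=1..n. 1) \<le> (\<Sum>i=1..n. card (D i))"
      using D_fin D_ne by (intro sum_mono) (simp add: Suc_le_eq card_gt_0_iff)
    then show ?thesis using assms(8) that by simp
  qed
  have g_top: "filterlim g at_top sequentially"
    by (rule filterlim_at_top_mono[OF filterlim_ident])
      (use g_ge in \<open>auto simp: eventually_sequentially\<close>)
  \<comment> \<open>The first \<open>g n\<close> terms of \<open>a\<close> list the first
    \<open>n\<close> layers without repetition, so the layer means are Cesaro means at the indices
    \<open>g n\<close>.\<close>
  have An_mean: "An n = fam_mean a {1..g n}" if "1 \<le> n" for n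
    using set_mean_image[OF inj_on_subset[OF inj], of "{1..g n}"] assms(9,11) that by auto
  have "(\<lambda>n. 2 * M / (real (g n) + 1)) \<longlonglongrightarrow> 0"
    by (rule filterlim_compose[OF _ g_top]) real_asymp
  \<comment> \<open>Here \<open>c\<close> is the sequence of Cesaro means, \<open>x\<close> that of
    the layer means, and \<open>e n\<close> is \<open>2 * M / (g n + 1)\<close>.\<close>
  with g_top An_mean have blocks: "An \<longlonglongrightarrow> A \<longleftrightarrow> (\<lambda>j. fam_mean a {1..j}) \<longlonglongrightarrow> A"
    by (rule tendsto_blockwise) (use assms(12) in blast)+
  have layers: "has_Miso H A \<longleftrightarrow> An \<longlonglongrightarrow> A"
  proof -
    have "(\<lambda>n. set_mean (\<Union>i\<in>{1..n}. D i)) \<longlonglongrightarrow> A \<longleftrightarrow> An \<longlonglongrightarrow> A"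
      by (rule filterlim_cong)
        (use assms(9) in \<open>auto simp: eventually_sequentially intro!: exI[of _ 1]\<close>)
    with has_Miso_iff_tendsto_layers[OF H t_image dec D] show ?thesis by simp
  qed
  have I: "I = dyadic ` {1..}"
    unfolding assms(13) by (auto simp: dyadic_def)
  have "has_ext_str I dist s A \<longleftrightarrow> (\<lambda>j. fam_mean a {1..j}) \<longlonglongrightarrow> A"
    unfolding I
  proof (rule has_ext_str_dyadic_iff[OF inj])
    show "\<bar>a n\<bar> \<le> M" if "1 \<le> n" for n
      using assms(4) a_in[OF that] by (simp add: less_imp_le)
  qed (use assms(14,15) in \<open>auto simp: dyadic_def I\<close>)
  with layers blocks show ?thesis by blast
qed

end
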